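(* Let $U$ be an open, convex and bounded subset of the upper half plane $\mathbb{R}^2_+$, with smooth boundary, such that the boundary $\partial U$ does not intersect the line $\{y=0\}$. Let $\Omega$ be the domain of $\mathbb{H}^1$ given by $\Omega=w^{-1}(U)$, and suppose that $\partial\Omega=w^{-1}(\partial U)$. Then $\Omega$ is a non characteristic domain of $\mathbb{H}^1$.
   Context: The Heisenberg group $\mathbb{H}^1$ has underlying manifold $\mathbb{C}\times\mathbb{R}=\mathbb{R}^3$, with points written $(z,t)=(x,y,t)$, $z=x+iy$, and group law $(z',t')\cdot(z,t)=(x+x',\,y+y',\,t+t'+2(xy'-x'y))$. Its horizontal distribution $\mathbf{H}$ is the plane field spanned by $X=\frac{\partial}{\partial x}+2y\frac{\partial}{\partial t}$ and $Y=\frac{\partial}{\partial y}-2x\frac{\partial}{\partial t}$, and the horizontal gradient is $\nabla_{\mathbb{H}^1}\varphi=(X\varphi,Y\varphi)$. The upper half plane is $\mathbb{R}^2_+=\{(x,y)\in\mathbb{R}^2 : y>0\}$, viewed inside $\mathbb{R}^2\cong\mathbb{C}$. The map $w:\mathbb{H}^1\to\mathbb{C}\cong\mathbb{R}^2$ is $w(z,t)=t+i|z|^2$, i.e. $(z,t)\mapsto(t,|z|^2)$. For a smooth domain $\Omega\subset\mathbb{H}^1$, a local defining function near $\xi_0\in\partial\Omega$ is a smooth real-valued function $\varphi$ on a neighborhood $B$ of $\xi_0$ with $\varphi=0$ on $B\cap\partial\Omega$, $\varphi<0$ on $B\cap\Omega$ and non-vanishing Euclidean gradient on $B\cap\partial\Omega$.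 A point $\xi_0\in\partial\Omega$ is characteristic if $\nabla_{\mathbb{H}^1}\varphi(\xi_0)=0$ for such a $\varphi$ (this is independent of the choice of $\varphi$); equivalently, $T_{\xi_0}\partial\Omega=\mathbf{H}_{\xi_0}$. The domain $\Omega$ is called non characteristic if its boundary has no characteristic points. *)

theory Defs
  imports "HOL-Analysis.Analysis"
begin

text \<open>The underlying manifold of \<open>\<H>\<^sup>1\<close>, with points \<open>(z, t)\<close>, \<open>z = x + iy\<close>.\<close>

type_synonym heisenberg = "complex \<times> real"

text \<open>\<open>C\<^sup>k\<close> regularity through iterated partial derivatives; meant for open sets.\<close>

primrec Ck_on :: "nat \<Rightarrow> 'a::euclidean_space set \<Rightarrow> ('a \<Rightarrow> real) \<Rightarrow> bool" where
  "Ck_on 0 B f \<longleftrightarrow> continuous_on B f"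
| "Ck_on (Suc k) B f \<longleftrightarrow>
     (\<forall>x\<in>B. f differentiable (at x)) \<and>
     (\<forall>b\<in>Basis. Ck_on k B (\<lambda>x. frechet_derivative f (at x) b))"

definition smooth_on :: "'a::euclidean_space set \<Rightarrow> ('a \<Rightarrow> real) \<Rightarrow> bool" where
  "smooth_on B f \<longleftrightarrow> (\<forall>k. Ck_on k B f)"

definition local_defining_function ::
    "'a::euclidean_space set \<Rightarrow> 'a \<Rightarrow> 'a set \<Rightarrow> ('a \<Rightarrow> real) \<Rightarrow> bool" where
  "local_defining_function \<Omega> \<xi> B \<phi> \<longleftrightarrow>
     open B \<and> \<xi> \<in> B \<and> smooth_on B \<phi> \<and>
     (\<forall>x \<in> B \<inter> frontier \<Omega>. \<phi> x = 0) \<and>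
     (\<forall>x \<in> B \<inter> \<Omega>. \<phi> x < 0) \<and>
     (\<forall>x \<in> B \<inter> frontier \<Omega>. \<exists>D. (GDERIV \<phi> x :> D) \<and> D \<noteq> 0)"

definition smooth_boundary :: "'a::euclidean_space set \<Rightarrow> bool" where
  "smooth_boundary \<Omega> \<longleftrightarrow>
     (\<forall>\<xi> \<in> frontier \<Omega>. \<exists>B \<phi>. local_defining_function \<Omega> \<xi> B \<phi>)"

text \<open>A domain is an open connected set; the empty set is not excluded.\<close>

definition smooth_domain :: "'a::euclidean_space set \<Rightarrow> bool" where
  "smooth_domain \<Omega> \<longleftrightarrow> open \<Omega> \<and> connected \<Omega> \<and> smooth_boundary \<Omega>"

text \<open>The vector fields \<open>X = \<partial>\<^sub>x + 2y \<partial>\<^sub>t\<close> and \<open>Y = \<partial>\<^sub>y - 2x \<partial>\<^sub>t\<close> spanning the horizontal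
  distribution; \<open>\<partial>\<^sub>x\<close>, \<open>\<partial>\<^sub>y\<close>, \<open>\<partial>\<^sub>t\<close> are the vectors \<open>(1, 0)\<close>, \<open>(\<i>, 0)\<close>, \<open>(0, 1)\<close>.\<close>

definition heis_X :: "heisenberg \<Rightarrow> heisenberg" where
  "heis_X \<xi> = (1, 2 * Im (fst \<xi>))"

definition heis_Y :: "heisenberg \<Rightarrow> heisenberg" where
  "heis_Y \<xi> = (\<i>, - 2 * Re (fst \<xi>))"

definition horizontal_gradient :: "(heisenberg \<Rightarrow> real) \<Rightarrow> heisenberg \<Rightarrow> real \<times> real" where
  "horizontal_gradient \<phi> \<xi> =
     (frechet_derivative \<phi> (at \<xi>) (heis_X \<xi>), frechet_derivative \<phi> (at \<xi>) (heis_Y \<xi>))"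

definition characteristic_point :: "heisenberg set \<Rightarrow> heisenberg \<Rightarrow> bool" where
  "characteristic_point \<Omega> \<xi> \<longleftrightarrow>
     \<xi> \<in> frontier \<Omega> \<and>
     (\<exists>B \<phi>. local_defining_function \<Omega> \<xi> B \<phi> \<and> horizontal_gradient \<phi> \<xi> = 0)"

definition non_characteristic_domain :: "heisenberg set \<Rightarrow> bool" where
  "non_characteristic_domain \<Omega> \<longleftrightarrow>
     smooth_domain \<Omega> \<and> (\<forall>\<xi> \<in> frontier \<Omega>. \<not> characteristic_point \<Omega> \<xi>)"

definition heis_w :: "heisenberg \<Rightarrow> complex" where
  "heis_w = (\<lambda>(z, t). Complex t ((cmod z)\<^sup>2))"

end

theory Submission
  imports Defs
begin

text \<open>A defining function \<open>\<phi>\<close> of \<open>U\<close> pulls back to the defining function \<open>\<phi> \<circ> w\<close> of \<open>\<Omega>\<close>, because \<open>w\<close>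
  is a submersion off \<open>z = 0\<close>. Since \<open>w\<close> is invariant under the rotations \<open>(z, t) \<mapsto> (e\<^sup>i\<^sup>\<theta> z, t)\<close>, so
  is \<open>\<partial>\<Omega>\<close>, and every gradient normal to \<open>\<partial>\<Omega>\<close> is orthogonal to \<open>(iz, 0)\<close>. At a characteristic
  point such a gradient is a multiple \<open>c (-2y, 2x, 1)\<close>, whose inner product with \<open>(iz, 0)\<close> is
  \<open>2c|z|\<^sup>2\<close>; hence \<open>c = 0\<close>, which is impossible.\<close>

section \<open>Closure of \<open>Ck_on\<close> under algebraic operations and composition\<close>

lemma Ck_on_cong:
  assumes "open A" "Ck_on k A f" "\<And>x. x \<in> A \<Longrightarrow> f x = g x"
  shows "Ck_on k A g"
  using assms(2,3)
proof (induction k arbitrary: f g)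
  case 0
  then show ?case by (simp cong: continuous_on_cong)
next
  case (Suc k)
  \<comment> \<open>Derivatives are local and \<open>A\<close> is open, so agreement on
    \<open>A\<close> passes to the partial derivatives, which then satisfy the induction
    hypothesis.\<close>
  have deriv: "(g has_derivative frechet_derivative f (at x)) (at x)" if "x \<in> A" for x
  proof (rule has_derivative_transform_within_open[OF _ assms(1) that])
    show "(f has_derivative frechet_derivative f (at x)) (at x)"
      using Suc.prems(1) that by (simp add: frechet_derivative_works)
  qed (use Suc.prems in auto)
  have "frechet_derivative f (at x) = frechet_derivative g (at x)" if "x \<in> A" for x
    using frechet_derivative_at[OF deriv[OF that]] .
  then have "Ck_on k A (\<lambda>x. frechet_derivative g (at x) b)" if "b \<in> Basis" for b
    using Suc.IH[of "\<lambda>x. frechet_derivative f (at x) b"] Suc.prems(1) that by simp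
  moreover have "g differentiable (at x)" if "x \<in> A" for x
    using deriv[OF that] by (rule differentiableI)
  ultimately show ?case by simp
qed

lemma Ck_on_SucD: "Ck_on (Suc k) A f \<Longrightarrow> Ck_on k A f"
proof (induction k arbitrary: f)
  case 0
  then show ?case
    by (auto intro!: continuous_at_imp_continuous_on differentiable_imp_continuous_within)
next
  case (Suc k)
  then show ?case by (metis Ck_on.simps(2))
qed

text \<open>By uniqueness of derivatives, an explicit formula \<open>f'\<close> can stand in for the
  chosen \<open>frechet_derivative\<close>; the later inductions all go through this rule.\<close>

lemma Ck_on_SucI:
  assumes "open A"
    and "\<And>x. x \<in> A \<Longrightarrow> (f has_derivative f' x) (at x)"
    and "\<And>b. b \<in> Basis \<Longrightarrow> Ck_on k A (\<lambda>x. f' x b)"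
  shows "Ck_on (Suc k) A f"
proof -
  have "f' x = frechet_derivative f (at x)" if "x \<in> A" for x
    using frechet_derivative_at[OF assms(2)[OF that]] .
  then have "Ck_on k A (\<lambda>x. frechet_derivative f (at x) b)" if "b \<in> Basis" for b
    using Ck_on_cong[OF assms(1) assms(3)[OF that]] by simp
  then show ?thesis
    using assms(2) by (auto intro: differentiableI)
qed

lemma Ck_on_has_derivative:
  "Ck_on (Suc k) A f \<Longrightarrow> x \<in> A \<Longrightarrow> (f has_derivative frechet_derivative f (at x)) (at x)"
  by (simp add: frechet_derivative_works)

lemma Ck_on_const: "open A \<Longrightarrow> Ck_on k A (\<lambda>x. c)"
proof (induction k arbitrary: c)
  case (Suc k)
  then show ?case
    by (intro Ck_on_SucI[where f' = "\<lambda>x h. 0"]) auto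
qed simp

lemma Ck_on_bounded_linear:
  assumes "open A" "bounded_linear f"
  shows "Ck_on k A f"
proof (cases k)
  case 0
  then show ?thesis
    using assms(2) by (simp add: linear_continuous_on)
next
  case (Suc m)
  show ?thesis
    unfolding Suc
    by (rule Ck_on_SucI[where f' = "\<lambda>x. f"])
      (use assms in \<open>auto intro: bounded_linear_imp_has_derivative Ck_on_const\<close>)
qed

lemma Ck_on_add:
  assumes "open A" "Ck_on k A f" "Ck_on k A g"
  shows "Ck_on k A (\<lambda>x. f x + g x)"
  using assms(2,3)
proof (induction k arbitrary: f g)
  case 0
  then show ?case by (simp add: continuous_on_add)
next
  case (Suc k)
  show ?case
    by (rule Ck_on_SucI[OF assms(1) has_derivative_add])
      (use Suc in \<open>auto intro: Ck_on_has_derivative\<close>)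
qed

lemma Ck_on_mult:
  assumes "open A" "Ck_on k A f" "Ck_on k A g"
  shows "Ck_on k A (\<lambda>x. f x * g x)"
  using assms(2,3)
proof (induction k arbitrary: f g)
  case 0
  then show ?case by (simp add: continuous_on_mult)
next
  case (Suc k)
  \<comment> \<open>The product rule pairs each derivative with an undifferentiated factor, so the
    factors themselves are needed at order \<open>k\<close>.\<close>
  have k: "Ck_on k A f" "Ck_on k A g"
    using Suc.prems Ck_on_SucD by blast+
  show ?case
  proof (rule Ck_on_SucI[OF assms(1)])
    show "((\<lambda>x. f x * g x) has_derivative (\<lambda>h. f x * frechet_derivative g (at x) h +
        frechet_derivative f (at x) h * g x)) (at x)" if "x \<in> A" for x
      using Suc.prems that by (intro has_derivative_mult Ck_on_has_derivative)
  qed (use Suc k in \<open>auto intro!: Ck_on_add[OF assms(1)]\<close>)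
qed

lemma Ck_on_sum:
  assumes "open A" "\<And>i. i \<in> I \<Longrightarrow> Ck_on k A (f i)"
  shows "Ck_on k A (\<lambda>x. \<Sum>i\<in>I. f i x)"
  using assms(2)
  by (induction I rule: infinite_finite_induct)
    (auto intro: Ck_on_const Ck_on_add assms(1))

text \<open>\<open>Ck_on\<close> is about real-valued functions, so \<open>g\<close> enters through
  its components. The induction varies \<open>f\<close> only: the chain rule produces partial
  derivatives of \<open>f\<close> composed with the same \<open>g\<close>.\<close>

lemma Ck_on_compose:
  fixes g :: "'a::euclidean_space \<Rightarrow> 'b::euclidean_space"
  assumes "open A" "g ` A \<subseteq> B" "Ck_on k B f"
    and "\<And>c. c \<in> Basis \<Longrightarrow> Ck_on k A (\<lambda>x. g x \<bullet> c)"
  shows "Ck_on k A (\<lambda>x. f (g x))"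
  using assms(3,4)
proof (induction k arbitrary: f)
  case 0
  then have "continuous_on A g" "continuous_on (g ` A) f"
    using assms(2) by (auto simp: continuous_on_componentwise[of A g] intro: continuous_on_subset)
  then show ?case
    by (simp add: continuous_on_compose2[of "g ` A" f])
next
  case (Suc k)
  define g' where "g' x h = (\<Sum>c\<in>Basis. frechet_derivative (\<lambda>x. g x \<bullet> c) (at x) h *\<^sub>R c)" for x h
  have g': "(g has_derivative g' x) (at x)" if "x \<in> A" for x
  proof -
    have "((\<lambda>x. g x \<bullet> c) has_derivative (\<lambda>h. g' x h \<bullet> c)) (at x)" if "c \<in> Basis" for c
      using Ck_on_has_derivative[OF Suc.prems(2)[OF that] \<open>x \<in> A\<close>] that
      by (simp add: g'_def inner_sum_left inner_Basis if_distrib cong: if_cong)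
    then show ?thesis
      using has_derivative_componentwise_within[of g "g' x" x UNIV] by simp
  qed
  \<comment> \<open>Expanding the chain rule in the basis leaves only sums and products of real
    functions.\<close>
  have "((\<lambda>x. f (g x)) has_derivative (\<lambda>h. \<Sum>c\<in>Basis.
      frechet_derivative (\<lambda>x. g x \<bullet> c) (at x) h * frechet_derivative f (at (g x)) c)) (at x)"
    if "x \<in> A" for x
  proof -
    have f': "(f has_derivative frechet_derivative f (at (g x))) (at (g x))"
      using Ck_on_has_derivative[OF Suc.prems(1)] assms(2) that by blast
    then interpret linear "frechet_derivative f (at (g x))"
      by (rule has_derivative_linear)
    show ?thesis
      using has_derivative_compose[OF g'[OF that] f'] by (simp add: g'_def sum scale)
  qed
  moreover have "Ck_on k A (\<lambda>x. \<Sum>c\<in>Basis.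
      frechet_derivative (\<lambda>x. g x \<bullet> c) (at x) b * frechet_derivative f (at (g x)) c)"
    if "b \<in> Basis" for b
  proof (intro Ck_on_sum Ck_on_mult assms(1))
    fix c :: 'b assume "c \<in> Basis"
    then show "Ck_on k A (\<lambda>x. frechet_derivative (\<lambda>x. g x \<bullet> c) (at x) b)"
      using Suc.prems(2) that by simp
    show "Ck_on k A (\<lambda>x. frechet_derivative f (at (g x)) c)"
      using Suc.prems(1) \<open>c \<in> Basis\<close>
      by (intro Suc.IH[of "\<lambda>y. frechet_derivative f (at y) c"] Ck_on_SucD[OF Suc.prems(2)]) simp_all
  qed
  ultimately show ?case
    by (rule Ck_on_SucI[OF assms(1)])
qed

section \<open>The map \<open>heis_w\<close> and preimages under it\<close>

lemma heis_w_eq: "heis_w \<xi> = Complex (snd \<xi>) (fst \<xi> \<bullet> fst \<xi>)"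
  by (cases \<xi>) (simp add: heis_w_def power2_norm_eq_inner)

lemma has_derivative_heis_w:
  "(heis_w has_derivative (\<lambda>h. Complex (snd h) (2 * (fst \<xi> \<bullet> fst h)))) (at \<xi>)"
  \<comment> \<open>As an inner product, |z|^2 is visibly differentiable at z = 0 too, where the
    norm is not.\<close>
  unfolding heis_w_eq[abs_def] Complex_eq
  by (auto intro!: derivative_eq_intros simp: inner_commute)

lemma continuous_heis_w: "continuous_on UNIV heis_w"
  using has_derivative_continuous[OF has_derivative_heis_w]
  by (simp add: continuous_at_imp_continuous_on)

lemma Ck_on_heis_w:
  assumes "open A" "c \<in> Basis"
  shows "Ck_on k A (\<lambda>\<xi>. heis_w \<xi> \<bullet> c)"
proof -
  have "Ck_on k A (\<lambda>\<xi>. Re (fst \<xi>) * Re (fst \<xi>) + Im (fst \<xi>) * Im (fst \<xi>))"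
    by (intro Ck_on_add Ck_on_mult Ck_on_bounded_linear assms(1) bounded_linear_fst
        bounded_linear_compose[OF bounded_linear_Re] bounded_linear_compose[OF bounded_linear_Im])
  moreover have "Ck_on k A (\<lambda>\<xi>::heisenberg. snd \<xi>)"
    by (intro Ck_on_bounded_linear assms(1) bounded_linear_snd)
  ultimately show ?thesis
    using assms(2) by (auto simp: Basis_complex_def heis_w_eq inner_complex_def)
qed

lemma local_defining_function_vimage_heis_w:
  assumes ldf: "local_defining_function U (heis_w \<xi>) B \<phi>"
    and frontier: "frontier (heis_w -` U) \<subseteq> heis_w -` frontier U"
    and upper: "\<And>p. p \<in> frontier U \<Longrightarrow> Im p > 0"
  shows "local_defining_function (heis_w -` U) \<xi> (heis_w -` B) (\<lambda>\<xi>. \<phi> (heis_w \<xi>))"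
  unfolding local_defining_function_def
proof (intro conjI ballI)
  have B: "open B" "smooth_on B \<phi>"
    using ldf by (auto simp: local_defining_function_def)
  show op: "open (heis_w -` B)"
    using open_vimage[OF B(1) continuous_heis_w] .
  show "smooth_on (heis_w -` B) (\<lambda>\<xi>. \<phi> (heis_w \<xi>))"
    using B(2) unfolding smooth_on_def by (auto intro: Ck_on_compose[OF op] Ck_on_heis_w[OF op])
next
  fix \<eta> assume \<eta>: "\<eta> \<in> heis_w -` B \<inter> frontier (heis_w -` U)"
  then have mem: "heis_w \<eta> \<in> B \<inter> frontier U"
    using frontier by auto
  then obtain E where E: "GDERIV \<phi> (heis_w \<eta>) :> E" "E \<noteq> 0"
    using ldf unfolding local_defining_function_def by blast
  have "fst \<eta> \<noteq> 0"
    using upper[of "heis_w \<eta>"] mem by (auto simp: heis_w_eq)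
  \<comment> \<open>This vector is the transposed derivative of \<open>heis_w\<close> applied to
    \<open>E\<close>; as z is nonzero, it vanishes only for \<open>E\<close> = 0.\<close>
  then have "((2 * Im E) *\<^sub>R fst \<eta>, Re E) \<noteq> 0"
    using E(2) by (auto simp: prod_eq_iff complex_eq_iff)
  moreover have "GDERIV (\<lambda>\<xi>. \<phi> (heis_w \<xi>)) \<eta> :> ((2 * Im E) *\<^sub>R fst \<eta>, Re E)"
    using has_derivative_compose[OF has_derivative_heis_w E(1)[unfolded gderiv_def]]
    by (simp add: gderiv_def inner_complex_def inner_prod_def algebra_simps)
  ultimately show "\<exists>D. (GDERIV (\<lambda>\<xi>. \<phi> (heis_w \<xi>)) \<eta> :> D) \<and> D \<noteq> 0"
    by blast
qed (use ldf frontier in \<open>auto simp: local_defining_function_def\<close>)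

text \<open>In polar coordinates \<open>w\<^sup>-\<^sup>1(U)\<close> is the image of \<open>U\<close> times a circle.\<close>

lemma connected_vimage_heis_w:
  assumes "connected U" "U \<subseteq> {p. Im p > 0}"
  shows "connected (heis_w -` U)"
proof -
  \<comment> \<open>\<open>p\<close> = t + i|z|^2 determines t and |z|; \<open>u\<close> supplies
    the lost angle of z.\<close>
  define f :: "complex \<times> complex \<Rightarrow> heisenberg"
    where "f = (\<lambda>(p, u). (complex_of_real (sqrt (Im p)) * u, Re p))"
  have "heis_w -` U = f ` (U \<times> sphere 0 1)"
  proof (intro equalityI subsetI)
    fix \<xi> assume "\<xi> \<in> heis_w -` U"
    \<comment> \<open>Needed because \<open>sgn 0 = 0\<close> is not on the circle.\<close>
    moreover from this have "fst \<xi> \<noteq> 0"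
      using assms(2) by (auto simp: heis_w_eq)
    moreover from this have "\<xi> = f (heis_w \<xi>, sgn (fst \<xi>))"
      by (cases \<xi>) (simp add: f_def heis_w_def sgn_eq)
    ultimately show "\<xi> \<in> f ` (U \<times> sphere 0 1)"
      by (intro image_eqI[where x = "(heis_w \<xi>, sgn (fst \<xi>))"]) (auto simp: norm_sgn)
  next
    fix \<xi> assume "\<xi> \<in> f ` (U \<times> sphere 0 1)"
    then show "\<xi> \<in> heis_w -` U"
      using assms(2) by (force simp: f_def heis_w_def norm_mult)
  qed
  moreover have "connected (U \<times> sphere (0::complex) 1)"
    using assms(1) by (intro connected_Times connected_sphere) auto
  moreover have "continuous_on (U \<times> sphere 0 1) f"
    unfolding f_def case_prod_beta by (intro continuous_intros)
  ultimately show ?thesis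
    by (simp add: connected_continuous_image)
qed

section \<open>Rotation invariance and characteristic points\<close>

lemma not_characteristic_point_rotation_invariant:
  assumes rot: "\<And>z t \<theta>. (z, t) \<in> frontier \<Omega> \<Longrightarrow> (cis \<theta> * z, t) \<in> frontier \<Omega>"
    and "fst \<xi> \<noteq> 0"
  shows "\<not> characteristic_point \<Omega> \<xi>"
proof
  assume "characteristic_point \<Omega> \<xi>"
  then obtain B \<phi> where \<xi>: "\<xi> \<in> frontier \<Omega>"
    and ldf: "local_defining_function \<Omega> \<xi> B \<phi>"
    and char: "horizontal_gradient \<phi> \<xi> = 0"
    unfolding characteristic_point_def by blast
  from ldf have B: "open B" "\<xi> \<in> B" and zero: "\<And>\<eta>. \<eta> \<in> B \<inter> frontier \<Omega> \<Longrightarrow> \<phi> \<eta> = 0"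
    by (auto simp: local_defining_function_def)
  obtain D where D: "GDERIV \<phi> \<xi> :> D" "D \<noteq> 0"
    using ldf \<xi> unfolding local_defining_function_def by blast
  then have der: "(\<phi> has_derivative (\<lambda>h. h \<bullet> D)) (at \<xi>)"
    by (simp add: gderiv_def)
  obtain z t where zt: "\<xi> = (z, t)"
    by (cases \<xi>)
  obtain d e where de: "D = (d, e)"
    by (cases D)
  have "heis_X \<xi> \<bullet> D = 0" "heis_Y \<xi> \<bullet> D = 0"
    using char frechet_derivative_at[OF der, symmetric]
    by (simp_all add: horizontal_gradient_def zero_prod_def)
  \<comment> \<open>Orthogonality to X and Y determines \<open>D\<close> up to the scalar
    \<open>e\<close>, its t-component.\<close>
  then have d: "Re d = - 2 * Im z * e" "Im d = 2 * Re z * e"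
    by (simp_all add: heis_X_def heis_Y_def zt de inner_prod_def inner_complex_def)
  \<comment> \<open>The rotation orbit of \<xi>; it stays in the frontier and has velocity (iz, 0)
    at angle 0.\<close>
  define \<gamma> where "\<gamma> \<theta> = (cis \<theta> * z, t)" for \<theta>
  have \<gamma>0: "\<gamma> 0 = \<xi>"
    by (simp add: \<gamma>_def zt)
  have \<gamma>: "(\<gamma> has_derivative (\<lambda>s. (of_real s * \<i> * z, 0))) (at 0)"
    unfolding \<gamma>_def by (auto intro!: derivative_eq_intros simp: scaleR_conv_of_real)
  have "((\<lambda>\<theta>. \<phi> (\<gamma> \<theta>)) has_derivative (\<lambda>s. (of_real s * \<i> * z, 0) \<bullet> D)) (at 0)"
    using has_derivative_compose[OF \<gamma>, of \<phi>] der by (simp add: \<gamma>0)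
  \<comment> \<open>\<phi> vanishes on the frontier, hence along the orbit while it remains in
    \<open>B\<close>.\<close>
  moreover have "((\<lambda>\<theta>. \<phi> (\<gamma> \<theta>)) has_derivative (\<lambda>s. 0)) (at 0)"
  proof (rule has_derivative_transform_within_open)
    show "open (\<gamma> -` B)"
      unfolding \<gamma>_def by (intro open_vimage B continuous_intros)
    show "0 \<in> \<gamma> -` B"
      using \<gamma>0 B(2) by simp
    show "0 = \<phi> (\<gamma> \<theta>)" if "\<theta> \<in> \<gamma> -` B" for \<theta>
      using zero[of "\<gamma> \<theta>"] that rot[of z t \<theta>] \<xi> by (simp add: \<gamma>_def zt)
  qed simp
  ultimately have "(of_real 1 * \<i> * z, 0) \<bullet> D = 0"
    by (metis has_derivative_unique)
  then have "2 * e * ((Re z)\<^sup>2 + (Im z)\<^sup>2) = 0"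
    by (simp add: de inner_prod_def inner_complex_def d power2_eq_square algebra_simps)
  moreover have "Re z \<noteq> 0 \<or> Im z \<noteq> 0"
    using \<open>fst \<xi> \<noteq> 0\<close> by (simp add: zt complex_eq_iff)
  ultimately have "e = 0"
    by auto
  with d D(2) de show False
    by (simp add: complex_eq_iff prod_eq_iff)
qed

theorem proposition3p2:
  fixes U :: "complex set" and \<Omega> :: "heisenberg set"
  assumes "open U" and "convex U" and "bounded U"
    and "U \<subseteq> {p. Im p > 0}"
    and "smooth_boundary U"
    and "frontier U \<inter> {p. Im p = 0} = {}"
    and "\<Omega> = heis_w -` U"
    and "frontier \<Omega> = heis_w -` frontier U"
  shows "non_characteristic_domain \<Omega>"
proof -
  \<comment> \<open>Taking closures gives only the weak inequality; the frontier avoiding the real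
    line makes it strict. This keeps \<partial>\<Omega> away from the axis z = 0.\<close>
  have upper: "Im p > 0" if "p \<in> frontier U" for p
  proof -
    have "closure U \<subseteq> {p. Im p \<ge> 0}"
      using assms(4) by (intro closure_minimal closed_halfspace_Im_ge) auto
    then have "Im p \<ge> 0" "Im p \<noteq> 0"
      using that assms(6) by (auto simp: frontier_def)
    then show ?thesis by simp
  qed
  have "smooth_boundary \<Omega>"
    unfolding smooth_boundary_def
  proof
    fix \<xi> assume "\<xi> \<in> frontier \<Omega>"
    then obtain B \<phi> where "local_defining_function U (heis_w \<xi>) B \<phi>"
      using assms(5,8) unfolding smooth_boundary_def by blast
    from local_defining_function_vimage_heis_w[OF this _ upper]
    show "\<exists>B \<phi>. local_defining_function \<Omega> \<xi> B \<phi>"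
      using assms(7,8) by blast
  qed
  moreover have "open \<Omega>"
    unfolding assms(7) by (rule open_vimage[OF assms(1) continuous_heis_w])
  moreover have "connected \<Omega>"
    unfolding assms(7) using assms(2,4) by (intro connected_vimage_heis_w convex_connected)
  moreover have "\<not> characteristic_point \<Omega> \<xi>" if "\<xi> \<in> frontier \<Omega>" for \<xi>
  proof (rule not_characteristic_point_rotation_invariant)
    show "(cis \<theta> * z, t) \<in> frontier \<Omega>" if "(z, t) \<in> frontier \<Omega>" for z t \<theta>
      using that by (simp add: assms(8) heis_w_def norm_mult)
    \<comment> \<open>|z|^2 is the imaginary part of \<open>heis_w \<xi>\<close>, positive by
      \<open>upper\<close>.\<close>
    show "fst \<xi> \<noteq> 0"
      using that upper[of "heis_w \<xi>"] by (auto simp: assms(8) heis_w_eq)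
  qed
  ultimately show ?thesis
    by (simp add: non_characteristic_domain_def smooth_domain_def)
qed

end
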